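(* Domain $T$ is not empty: there exists a probability distribution $P=\{p_k;k\ge 1\}$ on a countable alphabet that belongs to Domain $T$, i.e., that belongs to none of Domains 0, 1 and 2.
   Context: A probability distribution on the countable alphabet $\mathscr{X}=\{\ell_k;k\ge 1\}$ is a sequence $P=\{p_k;k\ge 1\}$ with $p_k\ge 0$ and $\sum_{k\ge1}p_k=1$. Its tail index is $t_n=\sum_{k\ge 1}np_k(1-p_k)^n$, $n\ge 1$. The distribution $P$ is said to belong to: Domain 0 if $\lim_{n\to\infty}t_n=0$; Domain 1 if $\limsup_{n\to\infty}t_n=c_P$ for some (finite) constant $c_P>0$; Domain 2 if $\lim_{n\to\infty}t_n=\infty$; and Domain $T$ (Transient) if it does not belong to Domains 0, 1 or 2. *)

theory Defs
  imports Complex_Main "HOL-Library.Extended_Real"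
begin

text \<open>
  A distribution on the alphabet \<open>{\<ell>\<^sub>k; k \<ge> 1}\<close> is identified with its sequence of
  probabilities \<open>p\<^sub>k\<close>, \<open>k \<ge> 1\<close>; the value \<open>p 0\<close> is never used, and series over \<open>k \<ge> 1\<close>
  are written with the summand at \<open>Suc k\<close>.
\<close>

definition prob_dist :: "(nat \<Rightarrow> real) \<Rightarrow> bool" where
  "prob_dist p \<longleftrightarrow> (\<forall>k\<ge>1. 0 \<le> p k) \<and> (\<lambda>k. p (Suc k)) sums 1"

definition tail_index :: "(nat \<Rightarrow> real) \<Rightarrow> nat \<Rightarrow> real" where
  "tail_index p n = (\<Sum>k. real n * p (Suc k) * (1 - p (Suc k)) ^ n)"

definition domain_0 :: "(nat \<Rightarrow> real) \<Rightarrow> bool" where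
  "domain_0 p \<longleftrightarrow> prob_dist p \<and> tail_index p \<longlonglongrightarrow> 0"

text \<open>The limit superior is taken in the extended reals, so that it always exists.\<close>

definition domain_1 :: "(nat \<Rightarrow> real) \<Rightarrow> bool" where
  "domain_1 p \<longleftrightarrow> prob_dist p \<and>
     (\<exists>c::real. c > 0 \<and> limsup (\<lambda>n. ereal (tail_index p n)) = ereal c)"

definition domain_2 :: "(nat \<Rightarrow> real) \<Rightarrow> bool" where
  "domain_2 p \<longleftrightarrow> prob_dist p \<and> filterlim (tail_index p) at_top sequentially"

definition domain_T :: "(nat \<Rightarrow> real) \<Rightarrow> bool" where
  "domain_T p \<longleftrightarrow> prob_dist p \<and> \<not> domain_0 p \<and> \<not> domain_1 p \<and> \<not> domain_2 p"

end

(*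
  Take blocks of 2(j+1) equal atoms p_j with total mass w_j = 1/a_j - 1/a_(j+1), so that the blocks
  from J on have mass 1/a_J exactly, where a_(j+1) = r_j^2 and r_j = 4(j+1) a_j.  Then
  1/r_j <= p_j <= 1/(2(j+1) a_j).  At n = (j+1) a_j the j-th block alone contributes at least
  (j+1)/4.  At n = a_(J+1) = r_J^2 the blocks up to J contribute at most n exp(-n/r_J) <= 2, the
  later ones at most n/a_(J+1) = 1.  So the tail index is unbounded but does not tend to infinity.
*)
theory Submission
  imports Defs "HOL-Analysis.Infinite_Sum" "HOL-Analysis.Elementary_Metric_Spaces"
begin

text \<open>The pair (j, i) stands for the i-th atom of block j; \<open>prod_decode\<close>
  enumerates all pairs, and positions with i >= m j are padded with zeros. Nonnegativity makes
  summation unconditional, so block-by-block sums may be reordered along the enumeration.\<close>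

lemma sums_blocks:
  fixes g :: "nat \<Rightarrow> real" and m :: "nat \<Rightarrow> nat"
  assumes nonneg: "\<And>j. g j \<ge> 0" and sums: "(\<lambda>j. real (m j) * g j) sums s"
  shows "(\<lambda>k. case prod_decode k of (j, i) \<Rightarrow> if i < m j then g j else 0) sums s"
proof -
  let ?f = "\<lambda>(j, i). if i < m j then g j else 0"
  have outer: "((\<lambda>j. real (m j) * g j) has_sum s) UNIV"
    using sums nonneg by (intro sums_nonneg_imp_has_sum) auto
  have inner: "((\<lambda>i. ?f (j, i)) has_sum real (m j) * g j) UNIV" for j
  proof -
    have "((\<lambda>i. ?f (j, i)) has_sum (\<Sum>i<m j. ?f (j, i))) UNIV"
      by (rule has_sum_finite_neutralI[of "{..<m j}"]) auto
    then show ?thesis by simp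
  qed
  have summable: "?f summable_on UNIV \<times> UNIV"
  proof (rule nonneg_bdd_above_summable_on)
    show "0 \<le> ?f x" for x using nonneg by (auto split: prod.splits)
    show "bdd_above (sum ?f ` {F. F \<subseteq> UNIV \<times> UNIV \<and> finite F})"
    proof (rule bdd_aboveI2)
      fix F :: "(nat \<times> nat) set"
      assume "F \<in> {F. F \<subseteq> UNIV \<times> UNIV \<and> finite F}"
      then have fin: "finite F" by simp
      \<comment> \<open>A finite set of pairs lies in the rectangle spanned by its two projections,
        over which the sum can be iterated.\<close>
      have "sum ?f F \<le> sum ?f (Sigma (fst ` F) (\<lambda>j. snd ` F))"
        using fin nonneg by (intro sum_mono2) force+
      also have "\<dots> = (\<Sum>j\<in>fst ` F. \<Sum>i\<in>snd ` F. ?f (j, i))"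
        using fin by (simp add: sum.Sigma)
      also have "\<dots> \<le> (\<Sum>j\<in>fst ` F. real (m j) * g j)"
      proof (rule sum_mono)
        fix j
        show "(\<Sum>i\<in>snd ` F. ?f (j, i)) \<le> real (m j) * g j"
          using finite_sum_le_has_sum[OF inner, of "snd ` F" j] fin nonneg by auto
      qed
      also have "\<dots> \<le> s"
        using finite_sum_le_has_sum[OF outer, of "fst ` F"] fin nonneg by auto
      finally show "sum ?f F \<le> s" .
    qed
  qed
  have "(?f has_sum s) (UNIV \<times> UNIV)"
    using inner outer summable by (rule has_sum_SigmaI)
  then have "((\<lambda>k. ?f (prod_decode k)) has_sum s) UNIV"
    using has_sum_reindex_bij_betw[OF bij_prod_decode, of ?f s] by simp
  then show ?thesis
    by (rule has_sum_imp_sums)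
qed

section \<open>Rapidly growing scales and the block distribution\<close>

fun scale :: "nat \<Rightarrow> nat" where
  "scale 0 = 1"
| "scale (Suc j) = (4 * Suc j * scale j)\<^sup>2"

definition block_mass :: "nat \<Rightarrow> real" where
  "block_mass j = 1 / scale j - 1 / scale (Suc j)"

definition atom :: "nat \<Rightarrow> real" where
  "atom j = block_mass j / (2 * Suc j)"

text \<open>The shift k - 1 matches an alphabet starting at 1. Padding letters have probability 0
  and contribute nothing to the mass or to the tail index.\<close>

definition block_dist :: "nat \<Rightarrow> real" where
  "block_dist k = (case prod_decode (k - 1) of (j, i) \<Rightarrow> if i < 2 * Suc j then atom j else 0)"

lemma scale_pos: "scale j > 0"
  by (induction j) auto

declare scale.simps(2) [simp del]

lemma scale_Suc_ge: "4 * Suc j * scale j \<le> scale (Suc j)"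
  by (simp only: scale.simps(2)) (rule self_le_power, use scale_pos[of j] in auto)

lemma scale_Suc_ge_double: "2 * scale j \<le> scale (Suc j)"
  by (rule order_trans[OF _ scale_Suc_ge]) auto

lemma scale_mono: "i \<le> j \<Longrightarrow> scale i \<le> scale j"
  by (rule lift_Suc_mono_le[of scale])
    (use scale_Suc_ge_double in \<open>auto intro: add_leD1 simp: mult_2\<close>)

lemma scale_ge: "Suc j \<le> scale j"
proof (induction j)
  case (Suc j)
  then show ?case using scale_Suc_ge_double[of j] by linarith
qed auto

lemma block_mass_le: "block_mass j \<le> 1 / scale j"
  by (simp add: block_mass_def)

text \<open>The scales at least double, so the subtracted reciprocal is at most half of the first
  one.\<close>

lemma block_mass_ge: "1 / (2 * scale j) \<le> block_mass j"
proof -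
  have "1 / real (scale (Suc j)) \<le> 1 / real (2 * scale j)"
    using scale_Suc_ge_double[of j] scale_pos[of j] by (intro divide_left_mono)
      (simp_all only: of_nat_le_iff, auto)
  then show ?thesis by (simp add: block_mass_def)
qed

lemma block_mass_nonneg: "0 \<le> block_mass j"
  using block_mass_ge[of j] by (rule order_trans[rotated]) simp

text \<open>The masses telescope and the reciprocal scales tend to 0. The case k = 0 gives total
  mass 1; larger k controls the late blocks.\<close>

lemma block_mass_sums_tail: "(\<lambda>j. block_mass (j + k)) sums (1 / scale k)"
proof -
  have "(\<lambda>j. 1 / real (scale j)) \<longlonglongrightarrow> 0"
  proof (rule tendsto_sandwich[OF _ _ tendsto_const LIMSEQ_inverse_real_of_nat])
    show "\<forall>\<^sub>F j in sequentially. 1 / real (scale j) \<le> inverse (real (Suc j))"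
    proof (rule always_eventually, rule allI)
      fix j
      have "real (Suc j) \<le> real (scale j)" using scale_ge[of j] by (simp only: of_nat_le_iff)
      then show "1 / real (scale j) \<le> inverse (real (Suc j))"
        by (simp add: inverse_eq_divide frac_le)
    qed
  qed auto
  then have "(\<lambda>j. 1 / real (scale (j + k))) \<longlonglongrightarrow> 0"
    by (rule LIMSEQ_ignore_initial_segment)
  from telescope_sums'[OF this] show ?thesis
    by (simp add: block_mass_def)
qed

lemma block_mass_sums: "block_mass sums 1"
  using block_mass_sums_tail[of 0] by simp

lemma atom_nonneg: "0 \<le> atom j"
  by (simp add: atom_def block_mass_nonneg)

lemma atom_le: "atom j \<le> 1 / (2 * Suc j * scale j)"
  using divide_right_mono[OF block_mass_le[of j], of "2 * Suc j"]
  by (simp add: atom_def algebra_simps)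

lemma atom_ge: "1 / (4 * Suc j * scale j) \<le> atom j"
  using divide_right_mono[OF block_mass_ge[of j], of "2 * Suc j"]
  by (simp add: atom_def algebra_simps)

lemma atom_le_one: "atom j \<le> 1"
proof (rule order_trans[OF atom_le])
  have "1 \<le> 2 * Suc j * scale j" using scale_pos[of j] by (simp add: Suc_le_eq)
  then have "1 \<le> real (2 * Suc j * scale j)" by linarith
  then show "1 / real (2 * Suc j * scale j) \<le> 1" by simp
qed

lemma prob_dist_block_dist: "prob_dist block_dist"
  unfolding prob_dist_def
proof
  show "\<forall>k\<ge>1. 0 \<le> block_dist k"
    by (auto simp: block_dist_def atom_nonneg split: prod.splits)
  have "(\<lambda>j. real (2 * Suc j) * atom j) sums 1"
    using block_mass_sums by (simp add: atom_def del: of_nat_Suc of_nat_mult)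
  then show "(\<lambda>k. block_dist (Suc k)) sums 1"
    using sums_blocks[of atom "\<lambda>j. 2 * Suc j" 1] atom_nonneg by (simp add: block_dist_def)
qed

section \<open>The tail index as a series over blocks\<close>

definition block_tail :: "nat \<Rightarrow> nat \<Rightarrow> real" where
  "block_tail n j = real n * block_mass j * (1 - atom j) ^ n"

lemma block_tail_nonneg: "0 \<le> block_tail n j"
  by (simp add: block_tail_def block_mass_nonneg atom_le_one)

lemma block_tail_le: "block_tail n j \<le> real n * block_mass j"
  unfolding block_tail_def
  by (rule mult_left_le) (auto simp: block_mass_nonneg atom_le_one atom_nonneg intro: power_le_one)

lemma summable_block_tail: "summable (block_tail n)"
proof (rule summable_comparison_test'[where N = 0])
  show "summable (\<lambda>j. real n * block_mass j)"
    using block_mass_sums by (intro summable_mult) (rule sums_summable)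
qed (use block_tail_nonneg block_tail_le in auto)

lemma tail_index_block_dist: "tail_index block_dist n = suminf (block_tail n)"
proof -
  define g where "g j = real n * atom j * (1 - atom j) ^ n" for j
  \<comment> \<open>The multiplicity of the equal atoms merges with the factor \<open>atom j\<close>
    into \<open>block_mass j\<close>.\<close>
  have "real (2 * Suc j) * g j = block_tail n j" for j
    by (simp add: g_def block_tail_def atom_def del: of_nat_Suc of_nat_mult)
  then have "(\<lambda>j. real (2 * Suc j) * g j) sums suminf (block_tail n)"
    using summable_block_tail by (simp add: summable_sums)
  moreover have "g j \<ge> 0" for j
    by (simp add: g_def atom_nonneg atom_le_one)
  ultimately have "(\<lambda>k. case prod_decode k of (j, i) \<Rightarrow> if i < 2 * Suc j then g j else 0)
      sums suminf (block_tail n)"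
    using sums_blocks[of g "\<lambda>j. 2 * Suc j"] by blast
  moreover have "(case prod_decode k of (j, i) \<Rightarrow> if i < 2 * Suc j then g j else 0) =
      real n * block_dist (Suc k) * (1 - block_dist (Suc k)) ^ n" for k
    by (auto simp: block_dist_def g_def split: prod.splits)
  ultimately show ?thesis
    by (simp add: tail_index_def sums_iff)
qed

text \<open>Splitting block j into 2 * Suc j atoms lets n exceed \<open>scale j\<close> by the
  factor Suc j while n * \<open>atom j\<close> stays at most 1/2. Bernoulli then keeps the power at
  least 1/2, and n * \<open>block_mass j\<close> is at least Suc j / 2.\<close>

lemma tail_index_block_dist_ge:
  "real (Suc j) / 4 \<le> tail_index block_dist (Suc j * scale j)"
proof -
  let ?n = "Suc j * scale j"
  have pos: "real (scale j) > 0" using scale_pos by simp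
  have n: "0 < real ?n" using scale_pos[of j] by (simp add: add_pos_nonneg)
  have "real ?n * atom j \<le> real ?n * (1 / (2 * real ?n))"
    using atom_le[of j] by (intro mult_left_mono) (auto simp: algebra_simps)
  also have "\<dots> = 1 / 2" using n by (simp only: mult_1_right times_divide_eq_right) auto
  finally have "1 / 2 \<le> 1 - real ?n * atom j" by simp
  also have "\<dots> \<le> (1 - atom j) ^ ?n"
    using Bernoulli_inequality[of "- atom j" ?n] atom_le_one by simp
  finally have power: "1 / 2 \<le> (1 - atom j) ^ ?n" .
  have "real (Suc j) / 2 = real ?n * (1 / (2 * scale j))"
    using pos by (simp add: field_simps)
  also have "\<dots> \<le> real ?n * block_mass j"
    by (intro mult_left_mono block_mass_ge) auto
  finally have mass: "real (Suc j) / 2 \<le> real ?n * block_mass j" .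
  have "real (Suc j) / 2 * (1 / 2) \<le> block_tail ?n j"
    unfolding block_tail_def by (rule mult_mono[OF mass power]) (auto simp: block_mass_nonneg)
  also have "\<dots> \<le> suminf (block_tail ?n)"
    using sum_le_suminf[OF summable_block_tail, of "{j}" ?n] block_tail_nonneg by simp
  finally show ?thesis by (simp add: tail_index_block_dist)
qed

text \<open>From 1 - x <= exp (-1/r) the power is at most exp (-r), and exp r >= r^2 / 2 by the
  quadratic Taylor bound.\<close>

lemma square_times_power_le_two:
  fixes x :: real and r :: nat
  assumes "0 < r" "1 / r \<le> x" "x \<le> 1"
  shows "real (r\<^sup>2) * (1 - x) ^ r\<^sup>2 \<le> 2"
proof -
  have "(1 - x) ^ r\<^sup>2 \<le> exp (- 1 / r) ^ r\<^sup>2"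
    using assms exp_ge_add_one_self[of "- 1 / r"] by (intro power_mono) auto
  also have "\<dots> = exp (- real r)"
    using assms by (simp add: exp_of_nat_mult[symmetric] power2_eq_square)
  finally have "real (r\<^sup>2) * (1 - x) ^ r\<^sup>2 \<le> real (r\<^sup>2) * exp (- real r)"
    by (intro mult_left_mono) auto
  also have "\<dots> \<le> 2"
    using exp_lower_Taylor_quadratic[of "real r"] by (simp add: exp_minus field_simps)
  finally show ?thesis .
qed

lemma tail_index_block_dist_le: "tail_index block_dist (scale (Suc J)) \<le> 3"
proof -
  define r where "r = 4 * Suc J * scale J"
  let ?n = "scale (Suc J)"
  have n: "?n = r\<^sup>2" by (simp add: r_def scale.simps(2))
  have r: "0 < r" using scale_pos by (simp add: r_def)
  \<comment> \<open>Monotonicity of the scales makes 1/r a common lower bound for all atoms up to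
    block J. Keeping the weight \<open>block_mass j\<close> in the estimate makes the bounds add up
    to at most 2, however many blocks there are.\<close>
  have early: "block_tail ?n j \<le> 2 * block_mass j" if "j \<le> J" for j
  proof -
    have "4 * Suc j * scale j \<le> r"
      unfolding r_def using that scale_mono[OF that] by (intro mult_le_mono) auto
    then have "real (4 * Suc j * scale j) \<le> real r" by linarith
    then have "1 / real r \<le> 1 / (4 * Suc j * scale j)"
      using scale_pos[of j] by (intro frac_le) auto
    then have "1 / real r \<le> atom j" using atom_ge[of j] by linarith
    then have "real ?n * (1 - atom j) ^ ?n \<le> 2"
      unfolding n using r atom_le_one by (intro square_times_power_le_two) auto
    from mult_right_mono[OF this block_mass_nonneg[of j]] show ?thesis
      by (simp add: block_tail_def mult_ac)
  qed
  have "sum (block_tail ?n) {..<Suc J} \<le> (\<Sum>j<Suc J. 2 * block_mass j)"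
    by (intro sum_mono early) auto
  also have "\<dots> \<le> 2"
    using sum_le_suminf[OF sums_summable[OF block_mass_sums], of "{..<Suc J}"]
      block_mass_nonneg sums_unique[OF block_mass_sums]
    by (simp add: sum_distrib_left[symmetric] del: sum.lessThan_Suc)
  finally have head: "sum (block_tail ?n) {..<Suc J} \<le> 2" .
  \<comment> \<open>For the later blocks the power is bounded by 1; their joint mass is exactly the
    reciprocal of n.\<close>
  have "(\<lambda>j. real ?n * block_mass (j + Suc J)) sums (real ?n * (1 / ?n))"
    by (intro sums_mult block_mass_sums_tail)
  then have "(\<lambda>j. real ?n * block_mass (j + Suc J)) sums 1"
    using scale_pos[of "Suc J"] by simp
  then have rest: "(\<Sum>j. block_tail ?n (j + Suc J)) \<le> 1"
    using suminf_le[of "\<lambda>j. block_tail ?n (j + Suc J)" "\<lambda>j. real ?n * block_mass (j + Suc J)"]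
      block_tail_le summable_block_tail summable_iff_shift[of "block_tail ?n" "Suc J"]
    by (simp add: sums_iff del: add_Suc_right)
  show ?thesis
    using head rest suminf_split_initial_segment[OF summable_block_tail, of ?n "Suc J"]
    by (simp add: tail_index_block_dist del: add_Suc_right sum.lessThan_Suc)
qed

text \<open>The peaks at Suc j * \<open>scale j\<close> are unbounded in position and in height.
  This one fact excludes both the limit 0 and a finite limit superior.\<close>

lemma tail_index_block_dist_not_eventually_less:
  "\<not> (\<forall>\<^sub>F n in sequentially. tail_index block_dist n < c)"
proof
  assume "\<forall>\<^sub>F n in sequentially. tail_index block_dist n < c"
  then obtain N where N: "\<And>n. n \<ge> N \<Longrightarrow> tail_index block_dist n < c"
    by (auto simp: eventually_sequentially)
  obtain M :: nat where M: "4 * c < real M"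
    using reals_Archimedean2 by blast
  \<comment> \<open>N places the peak beyond the threshold, and M lifts its height above c.\<close>
  define j where "j = max N M"
  have "N \<le> Suc j * 1" by (simp add: j_def)
  also have "\<dots> \<le> Suc j * scale j" using scale_pos[of j] by (intro mult_le_mono2) simp
  finally have "tail_index block_dist (Suc j * scale j) < c" by (rule N)
  moreover have "c < real (Suc j) / 4" using M by (simp add: j_def)
  ultimately show False using tail_index_block_dist_ge[of j] by linarith
qed

theorem mainTheorem6:
  "\<exists>p :: nat \<Rightarrow> real. domain_T p"
proof
  have "\<not> domain_0 block_dist"
    using order_tendstoD(2)[of "tail_index block_dist" 0 sequentially 1]
      tail_index_block_dist_not_eventually_less[of 1]
    by (auto simp: domain_0_def)
  moreover have "\<not> domain_1 block_dist"
  proof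
    assume "domain_1 block_dist"
    then obtain c where "limsup (\<lambda>n. ereal (tail_index block_dist n)) = ereal c"
      by (auto simp: domain_1_def)
    \<comment> \<open>Passing to c + 1 gives the strict inequality that turns a limit superior into
      an eventual bound.\<close>
    then have "limsup (\<lambda>n. ereal (tail_index block_dist n)) < ereal (c + 1)" by simp
    from Limsup_lessD[OF this] show False
      using tail_index_block_dist_not_eventually_less[of "c + 1"] by simp
  qed
  moreover have "\<not> domain_2 block_dist"
  proof
    assume "domain_2 block_dist"
    then have "\<forall>\<^sub>F n in sequentially. 3 < tail_index block_dist n"
      by (simp add: domain_2_def filterlim_at_top_dense)
    then obtain N where N: "\<And>n. n \<ge> N \<Longrightarrow> 3 < tail_index block_dist n"
      by (auto simp: eventually_sequentially)
    have "N \<le> scale (Suc N)" using scale_ge[of "Suc N"] by linarith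
    then show False using N[of "scale (Suc N)"] tail_index_block_dist_le[of N] by linarith
  qed
  ultimately show "domain_T block_dist"
    using prob_dist_block_dist by (simp add: domain_T_def)
qed

end
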